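(* In $\mathcal{P}_2(\mathbb{R}^2)$ let $$\nu_0=\delta_{(0,0)},\qquad \nu_1=\tfrac12\big(\delta_{(-1,-1)}+\delta_{(1,1)}\big),\qquad \nu_2=\tfrac12\big(\delta_{(1,-1)}+\delta_{(-1,1)}\big),$$ and consider the functional $\mathscr{E}:\mathcal{P}_2(\mathbb{R}^2)\to\mathbb{R}$, $$\mathscr{E}(\mu)=-W_2^2(\mu,\nu_0)+W_2^2(\mu,\nu_1)+W_2^2(\mu,\nu_2).$$ Then $\mathscr{E}$ admits a minimizer in $\mathcal{P}_2(\mathbb{R}^2)$, but the minimizer is not unique.
   Context: $\mathcal{P}_2(\mathbb{R}^2)$ is the set of Borel probability measures on $\mathbb{R}^2$ with finite second moment, $W_2$ is the 2-Wasserstein distance for the Euclidean norm, and $\delta_p$ is the Dirac mass at $p$. *)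

theory Defs
  imports "HOL-Probability.Probability"
begin

definition P2 :: "'a::euclidean_space measure set" where
  "P2 = {\<mu>. prob_space \<mu> \<and> sets \<mu> = sets borel \<and> integrable \<mu> (\<lambda>x. (norm x)\<^sup>2)}"

definition couplings ::
  "'a::euclidean_space measure \<Rightarrow> 'a measure \<Rightarrow> ('a \<times> 'a) measure set" where
  "couplings \<mu> \<nu> = {\<gamma>. prob_space \<gamma> \<and> sets \<gamma> = sets (borel \<Otimes>\<^sub>M borel) \<and>
     distr \<gamma> borel fst = \<mu> \<and> distr \<gamma> borel snd = \<nu>}"

(* The infimum is taken in [0, \<infinity>]; it is finite whenever both arguments lie in P2,
   so the conversion to a real number loses nothing there. *)
definition W2 :: "'a::euclidean_space measure \<Rightarrow> 'a measure \<Rightarrow> real" where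
  "W2 \<mu> \<nu> = sqrt (enn2real
     (INF \<gamma>\<in>couplings \<mu> \<nu>. \<integral>\<^sup>+ (x, y). ennreal ((dist x y)\<^sup>2) \<partial>\<gamma>))"

abbreviation dirac :: "'a::euclidean_space \<Rightarrow> 'a measure" where
  "dirac p \<equiv> return borel p"

definition half_sum ::
  "'a::euclidean_space measure \<Rightarrow> 'a measure \<Rightarrow> 'a measure" where
  "half_sum \<mu> \<nu> =
     measure_of UNIV (sets borel) (\<lambda>A. (emeasure \<mu> A + emeasure \<nu> A) / 2)"

(* measure_of yields the zero measure unless its argument is countably additive;
   the next two facts exclude this degenerate case. *)
lemma sets_half_sum [simp, measurable_cong]: "sets (half_sum \<mu> \<nu>) = sets borel"
  unfolding half_sum_def
  by (metis sets.sigma_sets_eq sets.space_closed sets_measure_of space_borel)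

lemma emeasure_half_sum:
  assumes "sets \<mu> = sets borel" "sets \<nu> = sets borel" "A \<in> sets borel"
  shows "emeasure (half_sum \<mu> \<nu>) A = (emeasure \<mu> A + emeasure \<nu> A) / 2"
proof (rule emeasure_measure_of[OF half_sum_def])
  show "sets borel \<subseteq> Pow UNIV" by simp
  show "A \<in> sets (half_sum \<mu> \<nu>)" using assms(3) by simp
  show "positive (sets (half_sum \<mu> \<nu>)) (\<lambda>A. (emeasure \<mu> A + emeasure \<nu> A) / 2)"
    by (simp add: positive_def)
  show "countably_additive (sets (half_sum \<mu> \<nu>)) (\<lambda>A. (emeasure \<mu> A + emeasure \<nu> A) / 2)"
  proof (rule countably_additiveI)
    fix F :: "nat \<Rightarrow> _"
    assume F: "range F \<subseteq> sets (half_sum \<mu> \<nu>)" "disjoint_family F"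
    have "(\<Sum>i. (emeasure \<mu> (F i) + emeasure \<nu> (F i)) / 2)
        = ((\<Sum>i. emeasure \<mu> (F i)) + (\<Sum>i. emeasure \<nu> (F i))) / 2"
      by (simp add: divide_ennreal_def suminf_add[symmetric])
    also have "\<dots> = (emeasure \<mu> (\<Union>i. F i) + emeasure \<nu> (\<Union>i. F i)) / 2"
      using F assms by (simp add: suminf_emeasure)
    finally show "(\<Sum>i. (emeasure \<mu> (F i) + emeasure \<nu> (F i)) / 2)
        = (emeasure \<mu> (\<Union>i. F i) + emeasure \<nu> (\<Union>i. F i)) / 2" .
  qed
qed

definition nu0 :: "(real^2) measure" where
  "nu0 = dirac (vector [0, 0])"

definition nu1 :: "(real^2) measure" where
  "nu1 = half_sum (dirac (vector [-1, -1])) (dirac (vector [1, 1]))"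

definition nu2 :: "(real^2) measure" where
  "nu2 = half_sum (dirac (vector [1, -1])) (dirac (vector [-1, 1]))"

definition energy :: "(real^2) measure \<Rightarrow> real" where
  "energy \<mu> = - (W2 \<mu> nu0)\<^sup>2 + (W2 \<mu> nu1)\<^sup>2 + (W2 \<mu> nu2)\<^sup>2"

end

theory Submission
  imports Defs
begin

text \<open>
  Write \<open>\<nu>\<^sub>1\<close> and \<open>\<nu>\<^sub>2\<close> as the symmetric two-point measures at \<open>\<plusminus>p\<close> and \<open>\<plusminus>q\<close>, where
  \<open>p \<bullet> q = 0\<close>. A coupling of \<open>\<mu>\<close> with \<open>\<nu>\<^sub>1\<close> costs at least the integral of the squared distance
  from \<open>x\<close> to \<open>{p, -p}\<close>, and likewise for \<open>\<nu>\<^sub>2\<close>. If \<open>y = \<plusminus>p\<close> and \<open>z = \<plusminus>q\<close>, then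
  \<open>|x - y|\<^sup>2 + |x - z|\<^sup>2 - |x|\<^sup>2 = |x - (y + z)|\<^sup>2 \<ge> 0\<close>, so the energy is nonnegative.
  Equality holds for \<open>x = y + z\<close>; the symmetric two-point measures at \<open>\<plusminus>(p + q)\<close> and at
  \<open>\<plusminus>(p - q)\<close> can both be transported optimally along this rule and have energy \<open>0\<close>.
\<close>

section \<open>Symmetric sums of two Dirac masses\<close>

lemma half_sum_commute: "half_sum \<mu> \<nu> = half_sum \<nu> \<mu>"
  by (simp add: half_sum_def add.commute)

text \<open>A fair coin chooses between the two atoms. Integrals, almost-everywhere statements and
  push-forwards of two-point measures thereby reduce to a finite computation on
  \<open>bool\<close>.\<close>

lemma half_sum_dirac_eq_distr:
  fixes a b :: "'a::euclidean_space"
  shows "half_sum (dirac a) (dirac b) =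
    distr (measure_pmf (bernoulli_pmf (1/2))) borel (\<lambda>c. if c then a else b)"
proof (rule measure_eqI)
  fix A assume "A \<in> sets (half_sum (dirac a) (dirac b))"
  then have A: "A \<in> sets borel" by simp
  have "emeasure (distr (measure_pmf (bernoulli_pmf (1/2))) borel (\<lambda>c. if c then a else b)) A
      = (\<integral>\<^sup>+ c. indicator A (if c then a else b) \<partial>measure_pmf (bernoulli_pmf (1/2)))"
    using A by (simp add: nn_integral_distr flip: nn_integral_indicator)
  also have "\<dots> = (indicator A a + indicator A b) / 2"
    by (simp add: divide_ennreal_def ennreal_divide_numeral distrib_right
        inverse_ennreal[symmetric] flip: ennreal_numeral)
  finally show "emeasure (half_sum (dirac a) (dirac b)) A =
      emeasure (distr (measure_pmf (bernoulli_pmf (1/2))) borel (\<lambda>c. if c then a else b)) A"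
    using A by (simp add: emeasure_half_sum)
qed simp

lemma prob_space_half_sum_dirac:
  "prob_space (half_sum (dirac a) (dirac b))"
  unfolding half_sum_dirac_eq_distr by (intro measure_pmf.prob_space_distr) simp

lemma nn_integral_half_sum_dirac:
  assumes [measurable]: "f \<in> borel_measurable borel"
  shows "(\<integral>\<^sup>+ x. f x \<partial>half_sum (dirac a) (dirac b)) = (f a + f b) / 2"
  unfolding half_sum_dirac_eq_distr
  by (simp add: nn_integral_distr divide_ennreal_def distrib_right
      inverse_ennreal[symmetric] flip: ennreal_numeral)

lemma AE_half_sum_dirac: "AE x in half_sum (dirac a) (dirac b). x \<in> {a, b}"
  unfolding half_sum_dirac_eq_distr by (subst AE_distr_iff) auto

lemma distr_half_sum_dirac:
  fixes a b :: "'a::euclidean_space" and f :: "'a \<Rightarrow> 'b::euclidean_space"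
  assumes "f \<in> borel_measurable borel"
  shows "distr (half_sum (dirac a) (dirac b)) borel f = half_sum (dirac (f a)) (dirac (f b))"
  unfolding half_sum_dirac_eq_distr using assms
  by (subst distr_distr) (auto simp: comp_def if_distrib cong: if_cong)

lemma half_sum_dirac_P2: "half_sum (dirac a) (dirac b) \<in> P2"
  unfolding P2_def
  by (auto simp: prob_space_half_sum_dirac integrable_iff_bounded nn_integral_half_sum_dirac
      ennreal_divide_eq_top_iff less_top[symmetric])

lemma dirac_P2: "dirac p \<in> P2"
  by (auto simp: P2_def prob_space_return integrable_iff_bounded nn_integral_return)

section \<open>Couplings and bounds on the Wasserstein distance\<close>

lemma product_in_couplings:
  assumes "\<mu> \<in> P2" "\<nu> \<in> P2"
  shows "\<mu> \<Otimes>\<^sub>M \<nu> \<in> couplings \<mu> \<nu>"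
proof -
  interpret M: prob_space \<mu> using assms by (simp add: P2_def)
  interpret N: prob_space \<nu> using assms by (simp add: P2_def)
  interpret pair_prob_space \<mu> \<nu> ..
  have [measurable_cong]: "sets \<mu> = sets borel" "sets \<nu> = sets borel"
    using assms by (auto simp: P2_def)
  have "distr (\<mu> \<Otimes>\<^sub>M \<nu>) borel fst = distr (\<mu> \<Otimes>\<^sub>M \<nu>) \<mu> fst"
    "distr (\<mu> \<Otimes>\<^sub>M \<nu>) borel snd = distr (\<mu> \<Otimes>\<^sub>M \<nu>) \<nu> snd"
    using assms by (auto intro!: distr_cong simp: P2_def)
  moreover have "distr (\<mu> \<Otimes>\<^sub>M \<nu>) \<mu> fst = \<mu>"
    by (simp add: N.distr_pair_fst N.emeasure_space_1)
  moreover have "distr (\<mu> \<Otimes>\<^sub>M \<nu>) \<nu> snd = \<nu>"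
  proof (rule measure_eqI)
    fix A assume "A \<in> sets (distr (\<mu> \<Otimes>\<^sub>M \<nu>) \<nu> snd)"
    then have A: "A \<in> sets \<nu>" by simp
    then have "snd -` A \<inter> space (\<mu> \<Otimes>\<^sub>M \<nu>) = space \<mu> \<times> A"
      using sets.sets_into_space by (auto simp: space_pair_measure)
    then show "emeasure (distr (\<mu> \<Otimes>\<^sub>M \<nu>) \<nu> snd) A = emeasure \<nu> A"
      using A by (simp add: emeasure_distr N.emeasure_pair_measure_Times M.emeasure_space_1)
  qed simp
  moreover have "sets (\<mu> \<Otimes>\<^sub>M \<nu>) = sets (borel \<Otimes>\<^sub>M borel)"
    using assms by (intro sets_pair_measure_cong) (auto simp: P2_def)
  ultimately show ?thesis
    using P.prob_space_axioms by (simp add: couplings_def)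
qed

text \<open>The bound \<open>(dist x y)\<^sup>2 \<le> 2 * (norm x)\<^sup>2 + 2 * (norm
  y)\<^sup>2\<close> controls the cost by the second moments of the two marginals.\<close>

lemma couplings_cost_finite:
  fixes \<mu> \<nu> :: "'a::euclidean_space measure"
  assumes "\<mu> \<in> P2" "\<nu> \<in> P2" and \<gamma>: "\<gamma> \<in> couplings \<mu> \<nu>"
  shows "(\<integral>\<^sup>+ (x, y). ennreal ((dist x y)\<^sup>2) \<partial>\<gamma>) < \<infinity>"
proof -
  have [measurable_cong]: "sets \<gamma> = sets (borel \<Otimes>\<^sub>M borel)"
    using \<gamma> by (simp add: couplings_def)
  have fin: "(\<integral>\<^sup>+ x. ennreal ((norm x)\<^sup>2) \<partial>\<rho>) < \<infinity>" if "\<rho> \<in> P2" for \<rho> :: "'a measure"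
    using that by (auto simp: P2_def integrable_iff_bounded)
  have "(\<integral>\<^sup>+ (x, y). ennreal ((dist x y)\<^sup>2) \<partial>\<gamma>)
      \<le> (\<integral>\<^sup>+ z. 2 * ennreal ((norm (fst z))\<^sup>2) + 2 * ennreal ((norm (snd z))\<^sup>2) \<partial>\<gamma>)"
  proof (rule nn_integral_mono, clarify, simp)
    fix x y :: 'a
    have "(dist x y)\<^sup>2 \<le> (norm x + norm y)\<^sup>2"
      by (intro power_mono) (auto simp: dist_norm norm_triangle_ineq4)
    also have "\<dots> \<le> 2 * (norm x)\<^sup>2 + 2 * (norm y)\<^sup>2"
      using sum_squares_bound[of "norm x" "norm y"] by (simp add: power2_sum)
    finally have "ennreal ((dist x y)\<^sup>2) \<le> ennreal (2 * (norm x)\<^sup>2 + 2 * (norm y)\<^sup>2)"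
      by (rule ennreal_leI)
    then show "ennreal ((dist x y)\<^sup>2) \<le> 2 * ennreal ((norm x)\<^sup>2) + 2 * ennreal ((norm y)\<^sup>2)"
      by (simp add: ennreal_mult)
  qed
  also have "\<dots> = 2 * (\<integral>\<^sup>+ x. ennreal ((norm x)\<^sup>2) \<partial>distr \<gamma> borel fst)
      + 2 * (\<integral>\<^sup>+ x. ennreal ((norm x)\<^sup>2) \<partial>distr \<gamma> borel snd)"
    by (simp add: nn_integral_add nn_integral_cmult nn_integral_distr)
  also have "\<dots> < \<infinity>"
    using fin[OF assms(1)] fin[OF assms(2)] \<gamma>
    by (simp add: couplings_def ennreal_mult_less_top)
  finally show ?thesis .
qed

text \<open>\<open>enn2real\<close> would send an infinite infimum to 0. The product coupling has
  finite cost and so excludes this; estimates can then be made in \<open>ennreal\<close>.\<close>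

lemma W2_sq_eq_INF:
  fixes \<mu> \<nu> :: "'a::euclidean_space measure"
  assumes "\<mu> \<in> P2" "\<nu> \<in> P2"
  shows "ennreal ((W2 \<mu> \<nu>)\<^sup>2) =
    (INF \<gamma>\<in>couplings \<mu> \<nu>. \<integral>\<^sup>+ (x, y). ennreal ((dist x y)\<^sup>2) \<partial>\<gamma>)"
proof -
  have "(INF \<gamma>\<in>couplings \<mu> \<nu>. \<integral>\<^sup>+ (x, y). ennreal ((dist x y)\<^sup>2) \<partial>\<gamma>)
      \<le> (\<integral>\<^sup>+ (x, y). ennreal ((dist x y)\<^sup>2) \<partial>(\<mu> \<Otimes>\<^sub>M \<nu>))"
    by (intro INF_lower product_in_couplings assms)
  also have "\<dots> < \<infinity>"
    by (intro couplings_cost_finite[OF assms] product_in_couplings assms)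
  finally show ?thesis
    by (simp add: W2_def less_top)
qed

text \<open>The second coordinate of any coupling lies in \<open>S\<close> almost surely, so its
  cost dominates \<open>g\<close> of the first coordinate, whose law is \<mu>. With \<open>g\<close>
  the squared distance to the support of \<nu>, this gives the lower bounds needed below.\<close>

lemma W2_sq_ge:
  fixes \<mu> \<nu> :: "'a::euclidean_space measure" and g :: "'a \<Rightarrow> real"
  assumes "\<mu> \<in> P2" "\<nu> \<in> P2"
    and [measurable]: "g \<in> borel_measurable borel"
    and S: "AE y in \<nu>. y \<in> S" and g: "\<And>x y. y \<in> S \<Longrightarrow> g x \<le> (dist x y)\<^sup>2"
  shows "(\<integral>\<^sup>+ x. ennreal (g x) \<partial>\<mu>) \<le> ennreal ((W2 \<mu> \<nu>)\<^sup>2)"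
  unfolding W2_sq_eq_INF[OF assms(1,2)]
proof (rule INF_greatest)
  fix \<gamma> assume \<gamma>: "\<gamma> \<in> couplings \<mu> \<nu>"
  then have [measurable_cong]: "sets \<gamma> = sets (borel \<Otimes>\<^sub>M borel)"
    by (simp add: couplings_def)
  have "distr \<gamma> borel snd = \<nu>"
    using \<gamma> by (simp add: couplings_def)
  then have "AE y in distr \<gamma> borel snd. y \<in> S"
    using S by metis
  then have AE: "AE z in \<gamma>. snd z \<in> S"
    by (intro AE_distrD[of snd \<gamma> borel]) auto
  have "(\<integral>\<^sup>+ x. ennreal (g x) \<partial>\<mu>) = (\<integral>\<^sup>+ x. ennreal (g x) \<partial>distr \<gamma> borel fst)"
    using \<gamma> by (simp add: couplings_def)
  also have "\<dots> = (\<integral>\<^sup>+ z. ennreal (g (fst z)) \<partial>\<gamma>)"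
    by (simp add: nn_integral_distr)
  also have "\<dots> \<le> (\<integral>\<^sup>+ (x, y). ennreal ((dist x y)\<^sup>2) \<partial>\<gamma>)"
    using AE by (intro nn_integral_mono_AE) (auto elim!: eventually_mono intro!: ennreal_leI g)
  finally show "(\<integral>\<^sup>+ x. ennreal (g x) \<partial>\<mu>) \<le> (\<integral>\<^sup>+ (x, y). ennreal ((dist x y)\<^sup>2) \<partial>\<gamma>)" .
qed

lemma W2_dirac_sq:
  fixes \<mu> :: "'a::euclidean_space measure"
  assumes \<mu>: "\<mu> \<in> P2"
  shows "ennreal ((W2 \<mu> (dirac p))\<^sup>2) = (\<integral>\<^sup>+ x. ennreal ((dist x p)\<^sup>2) \<partial>\<mu>)"
proof (rule antisym)
  interpret prob_space \<mu> using \<mu> by (simp add: P2_def)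
  have [measurable_cong]: "sets \<mu> = sets borel"
    using \<mu> by (simp add: P2_def)
  \<comment> \<open>All mass is sent to \<open>p\<close>; this coupling attains the lower
    bound.\<close>
  let ?\<gamma> = "distr \<mu> (borel \<Otimes>\<^sub>M borel) (\<lambda>x. (x, p))"
  have "distr \<mu> borel (\<lambda>x. x) = \<mu>"
    using \<mu> by (intro distr_id2) (simp add: P2_def)
  moreover have "distr \<mu> borel (\<lambda>x. p) = dirac p"
    by (rule measure_eqI) (simp_all add: emeasure_distr emeasure_space_1 indicator_def)
  ultimately have "?\<gamma> \<in> couplings \<mu> (dirac p)"
    by (auto simp: couplings_def distr_distr comp_def intro!: prob_space_distr)
  then have "ennreal ((W2 \<mu> (dirac p))\<^sup>2) \<le> (\<integral>\<^sup>+ (x, y). ennreal ((dist x y)\<^sup>2) \<partial>?\<gamma>)"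
    unfolding W2_sq_eq_INF[OF \<mu> dirac_P2] by (rule INF_lower)
  also have "\<dots> = (\<integral>\<^sup>+ x. ennreal ((dist x p)\<^sup>2) \<partial>\<mu>)"
    by (simp add: nn_integral_distr)
  finally show "ennreal ((W2 \<mu> (dirac p))\<^sup>2) \<le> \<dots>" .
  show "(\<integral>\<^sup>+ x. ennreal ((dist x p)\<^sup>2) \<partial>\<mu>) \<le> ennreal ((W2 \<mu> (dirac p))\<^sup>2)"
    by (rule W2_sq_ge[OF \<mu> dirac_P2, where S = "{p}"]) (auto simp: AE_return)
qed

text \<open>The transport plan moving \<open>a\<close> to \<open>c\<close> and \<open>b\<close> to
  \<open>d\<close>, with mass 1/2 each, has exactly this cost.\<close>

lemma W2_half_sum_dirac_sq_le:
  fixes a b c d :: "'a::euclidean_space"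
  shows "(W2 (half_sum (dirac a) (dirac b)) (half_sum (dirac c) (dirac d)))\<^sup>2
    \<le> ((dist a c)\<^sup>2 + (dist b d)\<^sup>2) / 2" (is "(W2 ?\<mu> ?\<nu>)\<^sup>2 \<le> ?r")
proof -
  let ?\<gamma> = "half_sum (dirac (a, c)) (dirac (b, d))"
  \<comment> \<open>\<open>half_sum\<close> carries the Borel sets of the product space, whereas
    \<open>couplings\<close> asks for the product sigma-algebra; \<open>borel_prod\<close>
    identifies them.\<close>
  have "sets ?\<gamma> = sets (borel \<Otimes>\<^sub>M borel)"
    by (simp only: sets_half_sum borel_prod)
  then have "?\<gamma> \<in> couplings ?\<mu> ?\<nu>"
    by (simp add: couplings_def prob_space_half_sum_dirac distr_half_sum_dirac
        borel_measurable_continuous_onI continuous_on_fst continuous_on_snd)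
  then have "ennreal ((W2 ?\<mu> ?\<nu>)\<^sup>2) \<le> (\<integral>\<^sup>+ (x, y). ennreal ((dist x y)\<^sup>2) \<partial>?\<gamma>)"
    unfolding W2_sq_eq_INF[OF half_sum_dirac_P2 half_sum_dirac_P2] by (rule INF_lower)
  also have "\<dots> = (\<integral>\<^sup>+ z. ennreal ((dist (fst z) (snd z))\<^sup>2) \<partial>?\<gamma>)"
    by (simp add: case_prod_unfold)
  also have "\<dots> = ennreal ?r"
    by (subst nn_integral_half_sum_dirac)
      (auto simp: divide_ennreal[symmetric] simp flip: ennreal_plus ennreal_numeral
        intro!: borel_measurable_continuous_onI continuous_intros)
  finally show ?thesis
    by (simp add: ennreal_le_iff)
qed

section \<open>Lower bound for the energy and its attainment\<close>

lemma W2_orthogonal_pairs: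
  fixes \<mu> :: "'a::euclidean_space measure"
  assumes \<mu>: "\<mu> \<in> P2" and "p \<bullet> q = 0"
  shows "(W2 \<mu> (dirac 0))\<^sup>2 \<le> (W2 \<mu> (half_sum (dirac (-p)) (dirac p)))\<^sup>2
    + (W2 \<mu> (half_sum (dirac (-q)) (dirac q)))\<^sup>2"
proof -
  have [measurable_cong]: "sets \<mu> = sets borel"
    using \<mu> by (simp add: P2_def)
  \<comment> \<open>This is the squared distance from \<open>x\<close> to the pair
    \<open>{-r, r}\<close>.\<close>
  define d where "d = (\<lambda>r x :: 'a. min ((dist x (-r))\<^sup>2) ((dist x r)\<^sup>2))"
  have [measurable]: "d r \<in> borel_measurable borel" for r
    unfolding d_def by measurable
  have bound: "(\<integral>\<^sup>+ x. ennreal (d r x) \<partial>\<mu>)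
      \<le> ennreal ((W2 \<mu> (half_sum (dirac (-r)) (dirac r)))\<^sup>2)" for r
    by (rule W2_sq_ge[OF \<mu> half_sum_dirac_P2 _ AE_half_sum_dirac]) (auto simp: d_def)
  have orth: "(norm x)\<^sup>2 \<le> (dist x y)\<^sup>2 + (dist x z)\<^sup>2" if "y \<bullet> z = 0" for x y z :: 'a
  proof -
    have "(dist x y)\<^sup>2 + (dist x z)\<^sup>2 - (norm x)\<^sup>2 = (norm (x - (y + z)))\<^sup>2"
      using that unfolding dist_norm power2_norm_eq_inner
      by (simp add: inner_simps inner_commute)
    also have "\<dots> \<ge> 0" by simp
    finally show ?thesis by simp
  qed
  have "(norm x)\<^sup>2 \<le> d p x + d q x" for x
    \<comment> \<open>Each minimum may be attained at either sign, which gives four orthogonal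
      pairs.\<close>
    using assms(2) orth[of p q x] orth[of "-p" q x] orth[of p "-q" x] orth[of "-p" "-q" x]
    unfolding d_def min_def by auto
  then have "ennreal ((norm x)\<^sup>2) \<le> ennreal (d p x) + ennreal (d q x)" for x
    by (simp add: d_def ennreal_leI flip: ennreal_plus)
  then have "(\<integral>\<^sup>+ x. ennreal ((norm x)\<^sup>2) \<partial>\<mu>)
      \<le> (\<integral>\<^sup>+ x. ennreal (d p x) \<partial>\<mu>) + (\<integral>\<^sup>+ x. ennreal (d q x) \<partial>\<mu>)"
    by (subst nn_integral_add[symmetric]) (auto intro!: nn_integral_mono)
  also note add_mono[OF bound bound]
  finally show ?thesis
    by (simp add: W2_dirac_sq[OF \<mu>, of 0, simplified, symmetric] flip: ennreal_plus)
qed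

text \<open>Moving \<open>p + q\<close> to \<open>p\<close> costs \<open>(norm q)\<^sup>2\<close>
  and moving it to \<open>q\<close> costs \<open>(norm p)\<^sup>2\<close>, and likewise at the
  opposite atom. By Pythagoras these add up to \<open>(norm (p + q))\<^sup>2\<close>, the squared
  distance of \<mu> from the Dirac mass at 0.\<close>

lemma W2_orthogonal_pairs_minimal:
  fixes p q :: "'a::euclidean_space"
  assumes "p \<bullet> q = 0" and \<mu>_def: "\<mu> = half_sum (dirac (-(p + q))) (dirac (p + q))"
  shows "(W2 \<mu> (half_sum (dirac (-p)) (dirac p)))\<^sup>2
    + (W2 \<mu> (half_sum (dirac (-q)) (dirac q)))\<^sup>2 \<le> (W2 \<mu> (dirac 0))\<^sup>2"
proof -
  have "ennreal ((W2 \<mu> (dirac 0))\<^sup>2) = ennreal ((norm (p + q))\<^sup>2)"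
    unfolding \<mu>_def W2_dirac_sq[OF half_sum_dirac_P2]
    by (subst nn_integral_half_sum_dirac)
      (auto simp: divide_ennreal norm_minus_commute[of "-p"] add.commute
        simp flip: ennreal_plus ennreal_numeral)
  then have "(W2 \<mu> (dirac 0))\<^sup>2 = (norm (p + q))\<^sup>2"
    by simp
  then have "(W2 \<mu> (dirac 0))\<^sup>2 = (norm p)\<^sup>2 + (norm q)\<^sup>2"
    using assms(1) by (simp add: power2_norm_eq_inner inner_simps inner_commute)
  moreover have "(W2 \<mu> (half_sum (dirac (-p)) (dirac p)))\<^sup>2 \<le> (norm q)\<^sup>2"
    using W2_half_sum_dirac_sq_le[of "-(p + q)" "p + q" "-p" p]
    by (simp add: \<mu>_def dist_norm)
  moreover have "(W2 \<mu> (half_sum (dirac (-q)) (dirac q)))\<^sup>2 \<le> (norm p)\<^sup>2"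
    using W2_half_sum_dirac_sq_le[of "-(p + q)" "p + q" "-q" q]
    by (simp add: \<mu>_def dist_norm)
  ultimately show ?thesis by simp
qed

theorem mainTheorem5:
  shows "(\<exists>\<mu>. is_arg_min energy (\<lambda>\<mu>. \<mu> \<in> P2) \<mu>) \<and>
         \<not> (\<exists>!\<mu>. is_arg_min energy (\<lambda>\<mu>. \<mu> \<in> P2) \<mu>)"
proof -
  \<comment> \<open>The signs are chosen so that the atoms of \<open>nu1\<close> and
    \<open>nu2\<close> appear in the order \<open>-p, p\<close> and \<open>-q, q\<close>.\<close>
  define p q :: "real^2" where "p = vector [1, 1]" and "q = vector [-1, 1]"
  have pq: "p \<bullet> q = 0"
    by (simp add: p_def q_def inner_vec_def sum_2)
  have "vector [0, 0] = (0::real^2)" "vector [-1, -1] = -p" "vector [1, -1] = -q"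
    by (simp_all add: p_def q_def vec_eq_iff forall_2)
  then have energy: "energy \<mu> = - (W2 \<mu> (dirac 0))\<^sup>2
      + (W2 \<mu> (half_sum (dirac (-p)) (dirac p)))\<^sup>2
      + (W2 \<mu> (half_sum (dirac (-q)) (dirac q)))\<^sup>2" for \<mu>
    by (simp add: energy_def nu0_def nu1_def nu2_def p_def q_def)
  have nonneg: "energy \<mu> \<ge> 0" if "\<mu> \<in> P2" for \<mu>
    using W2_orthogonal_pairs[OF that pq] by (simp add: energy)
  define m where "m = (\<lambda>a :: real^2. half_sum (dirac (-a)) (dirac a))"
  \<comment> \<open>Since 0 is a lower bound on \<open>P2\<close>, nonpositive energy already means
    minimality.\<close>
  have min: "is_arg_min energy (\<lambda>\<mu>. \<mu> \<in> P2) (m a)" if "energy (m a) \<le> 0" for a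
    using that nonneg half_sum_dirac_P2[of "-a" a]
    by (force simp: is_arg_min_def m_def not_less)
  have "energy (m (p + q)) \<le> 0"
    using W2_orthogonal_pairs_minimal[OF pq refl] by (simp add: energy m_def)
  moreover have "energy (m (p - q)) \<le> 0"
    \<comment> \<open>Replacing \<open>q\<close> by \<open>-q\<close> only swaps the atoms of
      \<open>nu2\<close>, which \<open>half_sum_commute\<close> undoes.\<close>
    using W2_orthogonal_pairs_minimal[of p "-q", OF _ refl] pq
    by (simp add: energy m_def half_sum_commute[of "dirac q"])
  moreover have "m (p + q) \<noteq> m (p - q)"
  proof
    assume "m (p + q) = m (p - q)"
    moreover have "p + q \<noteq> p - q" "p + q \<noteq> -(p - q)"
      by (simp_all add: p_def q_def vec_eq_iff forall_2)
    \<comment> \<open>The singleton \<open>{p + q}\<close> has positive mass under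
      \<open>m (p + q)\<close> and mass 0 under \<open>m (p - q)\<close>.\<close>
    ultimately show False
      using emeasure_half_sum[of "dirac (-(p + q))" "dirac (p + q)" "{p + q}"]
        emeasure_half_sum[of "dirac (-(p - q))" "dirac (p - q)" "{p + q}"]
      by (auto simp: m_def indicator_def split: if_splits)
  qed
  ultimately show ?thesis
    using min by blast
qed

end
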